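(* Let $S$ be a finite set, $\mu$ a probability mass function on $S$, $r:S\to\mathbb{R}$, and let $(Q(\epsilon;t):t\ge0,\epsilon>0)$ be a family of rate matrices on $S$ with associated transition matrices $(P(\epsilon;s,t):0\le s\le t,\epsilon>0)$. For $\epsilon>0$, let $s=s(\epsilon)=(\log(1/\epsilon))^{1+\delta}$ for some $\delta>0$. Suppose that $t=t(\epsilon)$ is such that $t/s\to\infty$ as $\epsilon\downarrow0$, and assume there exist matrices $\tilde Q,\tilde Q^{(1)}$ (not depending on $\epsilon$) such that $$\sup_{0\le u\le s}\|Q(\epsilon;t-u)-(\tilde Q-\epsilon\tilde Q^{(1)}u)\|=O(\epsilon^2s^2)$$ as $\epsilon\downarrow0$, where $\tilde Q$ is an irreducible rate matrix. Then $$\mu P(\epsilon;0,t)r=\tilde\pi r-\epsilon\tilde\pi\tilde Q^{(1)}(\tilde\Pi-\tilde Q)^{-2}r+O(\epsilon^2s^3)$$ as $\epsilon\downarrow0$, where $\tilde\pi$ is the stationary distribution associated with $\tilde Q$, and $\tilde\Pi$ is the rank one matrix having all rows identical to $\tilde\pi$.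
   Context: The matrix norm is $\|A\|=\max_x\sum_y|A(x,y)|$. Probability mass functions are row vectors and functions on $S$ are column vectors. A rate matrix has nonnegative off-diagonal entries and zero row sums. For each $\epsilon$, $(Q(\epsilon;t):t\ge0)$ is the family of rate matrices of an $S$-valued Markov jump process $X=(X(t):t\ge0)$ with non-stationary transition probabilities: for every $f:S\to\mathbb{R}$, $E[f(X(t+h))\mid X(u):0\le u\le t]=f(X(t))+(Q(\epsilon;t)f)(X(t))h+o(h)$ a.s. as $h\downarrow0$. The transition matrices are $P(\epsilon;s,t)=(P(X(t)=y\mid X(s)=x):x,y\in S)$ for $0\le s\le t$, and satisfy $P(\epsilon;0,u+v)=P(\epsilon;0,u)P(\epsilon;u,u+v)$.
   Formalization: The Markov jump process is additionally assumed to have no jumps at deterministic times; the one-sided expansion as h↓0 alone allows a forced reset at time t, for which the claimed expansion fails. *)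

theory Defs
  imports "HOL-Probability.Probability" "HOL-Library.Landau_Symbols"
begin

text \<open>
  The finite state space is a type \<open>'s::finite\<close>. A matrix on it is \<open>A :: real^'s^'s\<close> with
  \<open>A(x,y) = A $ x $ y\<close>; row vectors act by \<open>v*\<close>, column vectors by \<open>*v\<close>, and the product of
  a row vector \<open>v\<close> with a column vector \<open>r\<close> is \<open>v \<bullet> r\<close>.
\<close>

definition matrix_norm :: "real^'s^'s \<Rightarrow> real" where
  "matrix_norm A = (MAX x. \<Sum>y\<in>UNIV. \<bar>A $ x $ y\<bar>)"

definition rate_matrix :: "real^'s^'s \<Rightarrow> bool" where
  "rate_matrix A \<longleftrightarrow>
     (\<forall>x y. x \<noteq> y \<longrightarrow> 0 \<le> A $ x $ y) \<and> (\<forall>x. (\<Sum>y\<in>UNIV. A $ x $ y) = 0)"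

definition irreducible_matrix :: "real^'s^'s \<Rightarrow> bool" where
  "irreducible_matrix A \<longleftrightarrow> (\<forall>x y. (x, y) \<in> {(x, y). 0 < A $ x $ y}\<^sup>*)"

definition row_of_pmf :: "'s::finite pmf \<Rightarrow> real^'s" where
  "row_of_pmf p = (\<chi> x. pmf p x)"

definition stationary_distribution :: "real^'s^'s \<Rightarrow> 's pmf \<Rightarrow> bool" where
  "stationary_distribution A p \<longleftrightarrow> row_of_pmf p v* A = 0"

definition rank_one_matrix :: "'s::finite pmf \<Rightarrow> real^'s^'s" where
  "rank_one_matrix p = (\<chi> x. row_of_pmf p)"

definition natural_sigma_algebra ::
    "'w measure \<Rightarrow> (real \<Rightarrow> 'w \<Rightarrow> 's) \<Rightarrow> real \<Rightarrow> real \<Rightarrow> 'w measure" where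
  "natural_sigma_algebra M X s t =
     sigma (space M) {X u -` A \<inter> space M | u A. s \<le> u \<and> u \<le> t}"

text \<open>
  A non-stationary Markov process is given by its laws \<open>M s x\<close> when started in state \<open>x\<close> at
  time \<open>s\<close>, so that \<open>P(X(t) = y | X(s) = x)\<close> is defined for every \<open>x\<close>, including states
  which the process started at time 0 may fail to visit at time \<open>s\<close>.
\<close>

definition transition_matrix ::
    "(real \<Rightarrow> 's \<Rightarrow> 'w measure) \<Rightarrow> (real \<Rightarrow> 'w \<Rightarrow> 's) \<Rightarrow> real \<Rightarrow> real \<Rightarrow> real^'s::finite^'s" where
  "transition_matrix M X s t = (\<chi> x y. measure (M s x) {\<omega> \<in> space (M s x). X t \<omega> = y})"

text \<open>
  In \<open>rates\<close>, \<open>g h\<close> is a version of \<open>E[f(X(t+h)) | X(u) : s \<le> u \<le> t]\<close>: there are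
  uncountably many \<open>h\<close>, so an almost sure statement as \<open>h\<close> decreases to 0 needs a choice
  of versions. The condition \<open>jump_paths\<close> is right-continuity with left limits in the discrete
  topology, i.e. piecewise constant paths with finitely many jumps in bounded intervals. The
  one-sided expansion in \<open>rates\<close> does not see a jump at a deterministic time, which no rate matrix
  could account for; \<open>no_fixed_jump\<close> excludes those, as is usual for a process driven by
  rates.
\<close>

locale markov_jump_process =
  fixes M :: "real \<Rightarrow> 's::finite \<Rightarrow> 'w measure"
    and X :: "real \<Rightarrow> 'w \<Rightarrow> 's"
    and Q :: "real \<Rightarrow> real^'s^'s"
  assumes rate_matrix: "0 \<le> t \<Longrightarrow> rate_matrix (Q t)"
    and prob_space: "0 \<le> s \<Longrightarrow> prob_space (M s x)"
    and measurable: "0 \<le> s \<Longrightarrow> s \<le> t \<Longrightarrow> X t \<in> measurable (M s x) (count_space UNIV)"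
    and start: "0 \<le> s \<Longrightarrow> AE \<omega> in M s x. X s \<omega> = x"
    and jump_paths: "0 \<le> s \<Longrightarrow> AE \<omega> in M s x.
          (\<forall>t\<ge>s. \<forall>\<^sub>F u in at_right t. X u \<omega> = X t \<omega>) \<and>
          (\<forall>t>s. \<exists>y. \<forall>\<^sub>F u in at_left t. X u \<omega> = y)"
    and no_fixed_jump: "0 \<le> s \<Longrightarrow> s < t \<Longrightarrow>
          AE \<omega> in M s x. \<forall>\<^sub>F u in at_left t. X u \<omega> = X t \<omega>"
    and markov: "0 \<le> s \<Longrightarrow> s \<le> u \<Longrightarrow> u \<le> v \<Longrightarrow>
          AE \<omega> in M s x.
            real_cond_exp (M s x) (natural_sigma_algebra (M s x) X s u) (\<lambda>\<omega>. f $ X v \<omega>) \<omega> =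
            (transition_matrix M X u v *v f) $ X u \<omega>"
    and rates: "0 \<le> s \<Longrightarrow> s \<le> t \<Longrightarrow>
          \<exists>g. (\<forall>h>0. AE \<omega> in M s x.
                 real_cond_exp (M s x) (natural_sigma_algebra (M s x) X s t)
                   (\<lambda>\<omega>. f $ X (t + h) \<omega>) \<omega> = g h \<omega>) \<and>
              (AE \<omega> in M s x.
                 (\<lambda>h. g h \<omega> - (f $ X t \<omega> + (Q t *v f) $ X t \<omega> * h)) \<in> o[at_right 0](\<lambda>h. h))"

end

theory Submission
  imports Defs "HOL-Real_Asymp.Real_Asymp"
begin

text \<open>
  The row vector \<open>p v = \<mu> P(0, v)\<close> satisfies the forward equation \<open>p' = p Q(v)\<close>, with a right
  derivative. Put \<open>Z = (\<Pi> - Q0)\<^sup>-\<^sup>1\<close>, \<open>b = \<pi> Q1 Z\<close> and \<open>a = b Z\<close>. Since the rows of \<open>Q1\<close> sum to 0,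
  \<open>b Q0 = - \<pi> Q1\<close> and \<open>a Q0 = - b\<close>, so that \<open>q u = \<pi> - \<epsilon> (a + u b)\<close> solves the same equation in the
  reversed time \<open>u = t - v\<close> up to an error of order \<open>\<epsilon>\<^sup>2 s\<^sup>2\<close>, and \<open>q 0\<close> is the claimed expansion. The
  difference \<open>d v = p v - q (t - v)\<close> has total mass 0, and \<open>\<Sum>x. (d v x)\<^sup>2 / \<pi> x\<close> is a Lyapunov function:
  its dissipation under \<open>Q0\<close> is the Dirichlet form, which is coercive by irreducibility. Over the
  window \<open>[t - s, t]\<close> the initial difference is damped by \<open>exp (- c s)\<close>, which is smaller than every power
  of \<open>\<epsilon>\<close>, and what remains is of order \<open>\<epsilon>\<^sup>2 s\<^sup>2\<close>.
\<close>

section \<open>Differential inequalities for right derivatives\<close>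

text \<open>Only one-sided derivatives are at hand, so the mean value theorem does not apply.
  Tilting \<open>f\<close> by \<open>- \<eta> * x\<close> makes the right derivative strictly
  negative. The last point of the interval where the tilted function is at most its value at
  \<open>a\<close> must then be \<open>b\<close>, since from any earlier point it decreases
  further.\<close>

lemma right_derivative_nonpos_imp_nonincreasing:
  fixes f :: "real \<Rightarrow> real"
  assumes "a \<le> b" and cont: "continuous_on {a..b} f"
    and deriv: "\<And>x. a \<le> x \<Longrightarrow> x < b \<Longrightarrow> (f has_real_derivative D x) (at_right x)"
    and nonpos: "\<And>x. a \<le> x \<Longrightarrow> x < b \<Longrightarrow> D x \<le> 0"
  shows "f b \<le> f a"
proof (cases "a = b")
  case False
  with \<open>a \<le> b\<close> have "a < b" by simp
  show ?thesis
  proof (rule field_le_epsilon)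
    fix e :: real assume "0 < e"
    \<comment> \<open>Over the whole interval the tilt costs exactly
      \<open>\<eta> * (b - a) = e\<close>.\<close>
    define \<eta> where "\<eta> = e / (b - a)"
    have "\<eta> > 0" using \<open>0 < e\<close> \<open>a < b\<close> by (simp add: \<eta>_def)
    let ?g = "\<lambda>x. f x - \<eta> * x"
    let ?S = "{x\<in>{a..b}. ?g x \<le> ?g a}"
    have "closed ?S"
      by (intro continuous_on_closed_Collect_le continuous_intros cont)
    then have "compact ({a..b} \<inter> ?S)"
      by (rule compact_Int_closed[OF compact_Icc])
    also have "{a..b} \<inter> ?S = ?S" by blast
    finally have "compact ?S" .
    moreover have "a \<in> ?S" using \<open>a \<le> b\<close> by simp
    then have "?S \<noteq> {}" by (rule ex_in_conv[THEN iffD1, OF exI])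
    ultimately have "\<exists>c\<in>?S. \<forall>x\<in>?S. x \<le> c"
      by (rule compact_attains_sup)
    then obtain c where c: "c \<in> ?S" and c_max: "\<forall>x\<in>?S. x \<le> c"
      by (rule bexE)
    have "c = b"
    proof (rule ccontr)
      assume "c \<noteq> b"
      with c have "a \<le> c" "c < b" by auto
      have "(?g has_real_derivative D c - \<eta>) (at_right c)"
        using deriv[OF \<open>a \<le> c\<close> \<open>c < b\<close>] by (auto intro!: derivative_eq_intros)
      moreover have "D c - \<eta> < 0" using nonpos[OF \<open>a \<le> c\<close> \<open>c < b\<close>] \<open>\<eta> > 0\<close> by simp
      ultimately have "\<exists>d>0. \<forall>h>0. c + h \<in> {c<..} \<longrightarrow> h < d \<longrightarrow> ?g (c + h) < ?g c"
        by (rule has_real_derivative_neg_dec_right)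
      then obtain d where d: "d > 0" "\<And>h. h > 0 \<Longrightarrow> h < d \<Longrightarrow> ?g (c + h) < ?g c"
        by (metis greaterThan_iff less_add_same_cancel1)
      \<comment> \<open>Half of \<open>d\<close> stays in the range of strict decrease, and
        \<open>b - c\<close> keeps \<open>c + h\<close> in the interval; then \<open>c + h\<close>
        lies in the set and exceeds its maximum.\<close>
      define h where "h = min (d / 2) (b - c)"
      have h: "h > 0" "h < d" "c + h \<le> b" using d(1) \<open>c < b\<close> by (auto simp: h_def min_def)
      have "?g (c + h) \<le> ?g a" using d(2)[OF h(1,2)] c by simp
      then have "c + h \<in> ?S" using h \<open>a \<le> c\<close> by simp
      from c_max[rule_format, OF this] h(1) show False by simp
    qed
    with c have "f b - \<eta> * b \<le> f a - \<eta> * a" by simp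
    then have "f b \<le> f a + \<eta> * (b - a)" by (simp add: algebra_simps)
    then show "f b \<le> f a + e" using \<open>a < b\<close> by (simp add: \<eta>_def)
  qed
qed simp

text \<open>Gronwall's inequality: \<open>K / c\<close> is the equilibrium of
  \<open>f' = - c * f + K\<close>, and the integrating factor \<open>exp (c * (x - a))\<close> makes
  the deviation from it nonincreasing.\<close>

lemma right_derivative_exponential_decay:
  fixes f :: "real \<Rightarrow> real"
  assumes "a \<le> b" and cont: "continuous_on {a..b} f"
    and deriv: "\<And>x. a \<le> x \<Longrightarrow> x < b \<Longrightarrow> (f has_real_derivative D x) (at_right x)"
    and bound: "\<And>x. a \<le> x \<Longrightarrow> x < b \<Longrightarrow> D x \<le> - c * f x + K"
    and "c > 0" "K \<ge> 0"
  shows "f b \<le> exp (- c * (b - a)) * f a + K / c"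
proof -
  let ?g = "\<lambda>x. exp (c * (x - a)) * (f x - K / c)"
  have "?g b \<le> ?g a"
  proof (rule right_derivative_nonpos_imp_nonincreasing[OF \<open>a \<le> b\<close>])
    show "continuous_on {a..b} ?g" by (intro continuous_intros cont)
    fix x assume x: "a \<le> x" "x < b"
    show "(?g has_real_derivative exp (c * (x - a)) * (c * f x - K + D x)) (at_right x)"
      using deriv[OF x] \<open>c > 0\<close> by (auto intro!: derivative_eq_intros simp: field_simps)
    show "exp (c * (x - a)) * (c * f x - K + D x) \<le> 0"
      using bound[OF x] by (intro mult_nonneg_nonpos) auto
  qed
  then have "exp (c * (b - a)) * (f b - K / c) \<le> f a - K / c" by simp
  then have "f b - K / c \<le> (f a - K / c) / exp (c * (b - a))"
    by (simp add: pos_le_divide_eq mult.commute)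
  also have "\<dots> \<le> f a / exp (c * (b - a))"
    using \<open>c > 0\<close> \<open>K \<ge> 0\<close> by (intro divide_right_mono) auto
  also have "\<dots> = exp (- c * (b - a)) * f a"
    by (simp add: exp_minus divide_inverse)
  finally show ?thesis by simp
qed

section \<open>Irreducible rate matrices\<close>

lemma row_of_pmf_nth [simp]: "row_of_pmf p $ x = pmf p x"
  by (simp add: row_of_pmf_def)

lemma sum_pmf_UNIV: "(\<Sum>x\<in>UNIV. pmf (p :: 's::finite pmf) x) = 1"
  by (rule sum_pmf_eq_1) auto

lemma vector_matrix_mult_nth: "(v v* A) $ y = (\<Sum>x\<in>UNIV. v $ x * A $ x $ y)"
  by (simp add: vector_matrix_mult_def mult.commute)

lemma stationary_column_sum:
  assumes "stationary_distribution A \<pi>"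
  shows "(\<Sum>x\<in>UNIV. pmf \<pi> x * A $ x $ y) = 0"
  using assms by (simp add: stationary_distribution_def vec_eq_iff vector_matrix_mult_nth)

text \<open>Zeros of \<pi> propagate backwards along transitions. If \<pi> vanishes at
  \<open>v\<close>, the diagonal term of column \<open>v\<close> of the stationarity equation drops
  out and the others are nonnegative with sum 0, so \<pi> vanishes at every \<open>u\<close> with a
  positive rate to \<open>v\<close>. Irreducibility would spread this to all states, against total
  mass 1.\<close>

lemma irreducible_stationary_pos:
  assumes A: "rate_matrix A" "irreducible_matrix A" and st: "stationary_distribution A \<pi>"
  shows "0 < pmf \<pi> y"
proof (rule ccontr)
  assume "\<not> 0 < pmf \<pi> y"
  then have y: "pmf \<pi> y = 0" using pmf_nonneg[of \<pi> y] by linarith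
  have step: "pmf \<pi> u = 0" if "0 < A $ u $ v" "pmf \<pi> v = 0" for u v
  proof -
    have "\<forall>x\<in>UNIV. pmf \<pi> x * A $ x $ v = 0"
    proof (subst sum_nonneg_eq_0_iff[symmetric])
      show "0 \<le> pmf \<pi> x * A $ x $ v" for x
        using A(1) that(2) by (cases "x = v") (auto simp: rate_matrix_def)
    qed (auto simp: stationary_column_sum[OF st])
    with that(1) show ?thesis by (metis UNIV_I mult_eq_0_iff less_irrefl)
  qed
  have "pmf \<pi> x = 0" for x
  proof -
    have "(x, y) \<in> {(x, y). 0 < A $ x $ y}\<^sup>*" using A(2) by (simp add: irreducible_matrix_def)
    then show ?thesis
      by (induction rule: converse_rtrancl_induct) (auto intro: y step)
  qed
  with sum_pmf_UNIV[of \<pi>] show False by simp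
qed

text \<open>Expand the square: the terms in \<open>(h x)\<close> squared cancel because rows of
  \<open>A\<close> sum to 0, those in \<open>(h y)\<close> squared because \<pi> is stationary, and
  only the cross term is left.\<close>

lemma dirichlet_form:
  assumes "rate_matrix A" "stationary_distribution A \<pi>"
  shows "(\<Sum>y\<in>UNIV. (\<Sum>x\<in>UNIV. pmf \<pi> x * h x * A $ x $ y) * h y) =
    - (\<Sum>x\<in>UNIV. \<Sum>y\<in>UNIV. pmf \<pi> x * A $ x $ y * (h x - h y)\<^sup>2) / 2"
proof -
  have row: "(\<Sum>y\<in>UNIV. A $ x $ y) = 0" for x using assms(1) by (simp add: rate_matrix_def)
  have "(\<Sum>x\<in>UNIV. \<Sum>y\<in>UNIV. pmf \<pi> x * A $ x $ y * (h x - h y)\<^sup>2) =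
     (\<Sum>x\<in>UNIV. \<Sum>y\<in>UNIV. (pmf \<pi> x * (h x)\<^sup>2) * A $ x $ y) +
     (\<Sum>x\<in>UNIV. \<Sum>y\<in>UNIV. (pmf \<pi> x * A $ x $ y) * (h y)\<^sup>2) -
     2 * (\<Sum>x\<in>UNIV. \<Sum>y\<in>UNIV. pmf \<pi> x * h x * A $ x $ y * h y)"
    by (simp add: sum_distrib_left sum.distrib[symmetric] sum_subtractf[symmetric])
       (intro sum.cong refl, simp add: power2_eq_square algebra_simps)
  also have "(\<Sum>x\<in>UNIV. \<Sum>y\<in>UNIV. (pmf \<pi> x * (h x)\<^sup>2) * A $ x $ y) = 0"
    by (simp add: sum_distrib_left[symmetric] row)
  also have "(\<Sum>x\<in>UNIV. \<Sum>y\<in>UNIV. (pmf \<pi> x * A $ x $ y) * (h y)\<^sup>2) = 0"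
    by (subst sum.swap) (simp add: sum_distrib_right[symmetric] stationary_column_sum[OF assms(2)])
  also have "(\<Sum>x\<in>UNIV. \<Sum>y\<in>UNIV. pmf \<pi> x * h x * A $ x $ y * h y) =
     (\<Sum>y\<in>UNIV. (\<Sum>x\<in>UNIV. pmf \<pi> x * h x * A $ x $ y) * h y)"
    by (subst sum.swap) (simp add: sum_distrib_right)
  finally show ?thesis by simp
qed

text \<open>In terms of the density \<open>h\<close> of \<open>d\<close> with respect to \<pi>, the
  form is minus half the Dirichlet sum. If that vanishes, \<open>h\<close> agrees across each
  transition, so it is constant by irreducibility, and mass 0 makes the constant 0.\<close>

lemma weighted_form_negative:
  fixes d :: "real^'s::finite"
  assumes A: "rate_matrix A" "irreducible_matrix A" and st: "stationary_distribution A \<pi>"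
    and d: "(\<Sum>x\<in>UNIV. d $ x) = 0" "d \<noteq> 0"
  shows "(\<Sum>y\<in>UNIV. (d v* A) $ y * d $ y / pmf \<pi> y) < 0"
proof -
  define h where "h x = d $ x / pmf \<pi> x" for x
  have pos: "0 < pmf \<pi> x" for x by (rule irreducible_stationary_pos[OF A st])
  have dh: "d $ x = pmf \<pi> x * h x" for x using pos[of x] by (simp add: h_def)
  let ?E = "\<lambda>x y. pmf \<pi> x * A $ x $ y * (h x - h y)\<^sup>2"
  have E0: "0 \<le> ?E x y" for x y
    using A(1) by (cases "x = y") (auto simp: rate_matrix_def)
  have eq: "(\<Sum>y\<in>UNIV. (d v* A) $ y * d $ y / pmf \<pi> y) = - (\<Sum>x\<in>UNIV. \<Sum>y\<in>UNIV. ?E x y) / 2"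
    using dirichlet_form[OF A(1) st, of h] pos
    by (simp add: vector_matrix_mult_nth dh less_imp_neq[THEN not_sym])
  have "(\<Sum>x\<in>UNIV. \<Sum>y\<in>UNIV. ?E x y) \<noteq> 0"
  proof
    assume "(\<Sum>x\<in>UNIV. \<Sum>y\<in>UNIV. ?E x y) = 0"
    then have "\<forall>x y. ?E x y = 0"
      by (simp add: sum_nonneg_eq_0_iff sum_nonneg E0)
    then have E: "?E x y = 0" for x y by blast
    have const: "h x = h y" for x y
    proof -
      have "(x, y) \<in> {(x, y). 0 < A $ x $ y}\<^sup>*" using A(2) by (simp add: irreducible_matrix_def)
      then show ?thesis
      proof (induction rule: converse_rtrancl_induct)
        case (step u v)
        then show ?case using E[of u v] pos[of u] by simp
      qed simp
    qed
    \<comment> \<open>Here \<open>undefined\<close> is just some state, at which the constant value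
      of \<open>h\<close> is read off.\<close>
    have "(\<Sum>x\<in>UNIV. d $ x) = (\<Sum>x\<in>UNIV. pmf \<pi> x * h undefined)"
      by (intro sum.cong refl) (metis dh const)
    then have "h undefined = 0"
      by (simp add: d(1) sum_distrib_right[symmetric] sum_pmf_UNIV)
    then have "d = 0" by (simp add: vec_eq_iff dh) (metis const)
    with d(2) show False by simp
  qed
  moreover have "0 \<le> (\<Sum>x\<in>UNIV. \<Sum>y\<in>UNIV. ?E x y)" by (intro sum_nonneg E0)
  ultimately show ?thesis unfolding eq by linarith
qed

text \<open>Compactness: on the unit sphere of the mass-zero subspace the continuous form attains
  its maximum, which is negative. Homogeneity of degree 2 carries the bound to all \<open>d\<close>
  of mass 0.\<close>

lemma weighted_form_coercive:
  fixes A :: "real^'s::finite^'s"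
  assumes A: "rate_matrix A" "irreducible_matrix A" and st: "stationary_distribution A \<pi>"
  obtains c where "c > 0"
    and "\<And>d. (\<Sum>x\<in>UNIV. d $ x) = 0 \<Longrightarrow>
      (\<Sum>y\<in>UNIV. (d v* A) $ y * d $ y / pmf \<pi> y) \<le> - c * (norm d)\<^sup>2"
proof -
  define W where "W d = (\<Sum>y\<in>UNIV. (d v* A) $ y * d $ y / pmf \<pi> y)" for d
  have W_scale: "W (k *\<^sub>R d) = k\<^sup>2 * W d" for k d
    unfolding W_def vector_matrix_mult_nth
    by (simp add: sum_distrib_left power2_eq_square mult_ac sum_distrib_right)
  let ?S = "sphere 0 1 \<inter> {d :: real^'s. (\<Sum>x\<in>UNIV. d $ x) = 0}"
  have cont: "continuous_on ?S W"
    unfolding W_def vector_matrix_mult_nth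
    using irreducible_stationary_pos[OF A st]
    by (intro continuous_intros) (auto simp: less_le)
  have "closed {d :: real^'s. (\<Sum>x\<in>UNIV. d $ x) = 0}"
    by (intro closed_Collect_eq continuous_intros)
  then have comp: "compact ?S" by (intro compact_Int_closed) auto
  have "\<exists>c>0. \<forall>d\<in>?S. W d \<le> - c"
  proof (cases "?S = {}")
    \<comment> \<open>This is the case of a single state, where the only vector of mass 0 is 0; any
      positive constant will do.\<close>
    case True
    then show ?thesis by (intro exI[of _ 1]) simp
  next
    case False
    from continuous_attains_sup[OF comp False cont]
    obtain d where d: "d \<in> ?S" "\<forall>e\<in>?S. W e \<le> W d" by blast
    have "W d < 0"
      unfolding W_def using d(1) by (intro weighted_form_negative[OF A st]) auto
    with d(2) show ?thesis by (intro exI[of _ "- W d"]) auto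
  qed
  then obtain c where c: "c > 0" "\<And>d. d \<in> ?S \<Longrightarrow> W d \<le> - c" by blast
  show ?thesis
  proof (rule that[OF c(1)])
    fix d :: "real^'s" assume d: "(\<Sum>x\<in>UNIV. d $ x) = 0"
    have "W d \<le> - c * (norm d)\<^sup>2"
    proof (cases "d = 0")
      case True
      then show ?thesis by (simp add: W_def)
    next
      case False
      have "(1 / norm d) *\<^sub>R d \<in> ?S"
        using d False by (simp add: sum_divide_distrib[symmetric])
      from c(2)[OF this] False show ?thesis
        unfolding W_scale by (simp add: field_simps power2_eq_square)
    qed
    then show "(\<Sum>y\<in>UNIV. (d v* A) $ y * d $ y / pmf \<pi> y) \<le> - c * (norm d)\<^sup>2"
      by (simp add: W_def)
  qed
qed

section \<open>The fundamental matrix and the Poisson equation\<close>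

lemma rank_one_matrix_mult_vec: "rank_one_matrix \<pi> *v h = (row_of_pmf \<pi> \<bullet> h) *\<^sub>R 1"
  by (simp add: rank_one_matrix_def matrix_vector_mult_def vec_eq_iff inner_vec_def)

text \<open>The kernel is trivial. Pairing \<open>(\<Pi> - A) h = 0\<close> with \<pi> gives
  \<open>\<pi> h = 0\<close> by stationarity, hence \<open>A h = 0\<close>. The vector
  \<open>d\<close> with density \<open>h\<close> then has mass 0, and its weighted form
  \<open>(d A) h = d (A h)\<close> is 0, which forces \<open>d = 0\<close>.\<close>

lemma invertible_fundamental_matrix:
  fixes A :: "real^'s::finite^'s"
  assumes A: "rate_matrix A" "irreducible_matrix A" and st: "stationary_distribution A \<pi>"
  shows "invertible (rank_one_matrix \<pi> - A)"
  unfolding invertible_left_inverse matrix_left_invertible_ker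
proof (intro allI impI)
  fix h assume h: "(rank_one_matrix \<pi> - A) *v h = 0"
  have st': "row_of_pmf \<pi> \<bullet> (A *v h) = 0"
    using st by (simp add: stationary_distribution_def dot_lmul_matrix[symmetric])
  have "row_of_pmf \<pi> \<bullet> 1 = 1" by (simp add: inner_vec_def sum_pmf_UNIV)
  moreover have "row_of_pmf \<pi> \<bullet> ((rank_one_matrix \<pi> - A) *v h) = 0" by (simp add: h)
  ultimately have h0: "row_of_pmf \<pi> \<bullet> h = 0"
    by (simp add: matrix_vector_mult_diff_rdistrib rank_one_matrix_mult_vec inner_diff_right st')
  with h have Ah: "A *v h = 0"
    by (simp add: matrix_vector_mult_diff_rdistrib rank_one_matrix_mult_vec)
  define d where "d = (\<chi> x. pmf \<pi> x * h $ x)"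
  have pos: "0 < pmf \<pi> x" for x by (rule irreducible_stationary_pos[OF A st])
  have "d = 0"
  proof (rule ccontr)
    assume "d \<noteq> 0"
    have "(\<Sum>x\<in>UNIV. d $ x) = 0" using h0 by (simp add: d_def inner_vec_def)
    from weighted_form_negative[OF A st this \<open>d \<noteq> 0\<close>]
    have "(\<Sum>y\<in>UNIV. (d v* A) $ y * d $ y / pmf \<pi> y) < 0" .
    moreover have "(\<Sum>y\<in>UNIV. (d v* A) $ y * d $ y / pmf \<pi> y) = (d v* A) \<bullet> h"
      using pos by (simp add: inner_vec_def d_def less_imp_neq[THEN not_sym])
    ultimately show False by (simp add: dot_lmul_matrix Ah)
  qed
  then show "h = 0" using pos by (simp add: d_def vec_eq_iff less_imp_neq[THEN not_sym])
qed

lemma inner_one_right: "(w :: real^'s::finite) \<bullet> 1 = (\<Sum>x\<in>UNIV. w $ x)"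
  by (simp add: inner_vec_def)

lemma rate_matrix_mult_one: "rate_matrix A \<Longrightarrow> A *v 1 = 0"
  by (simp add: rate_matrix_def matrix_vector_mult_def vec_eq_iff)

text \<open>Solves the Poisson equation for a row vector of mass 0. Since \<open>\<Pi> - A\<close>
  fixes the vector 1, \<open>c\<close> has the same mass as \<open>w\<close>, namely 0; hence
  \<open>c \<Pi> = 0\<close>, and \<open>c (\<Pi> - A) = w\<close> reduces to
  \<open>c A = - w\<close>.\<close>

lemma fundamental_matrix_solution:
  fixes A :: "real^'s::finite^'s" and w :: "real^'s"
  assumes A: "rate_matrix A" "irreducible_matrix A" and st: "stationary_distribution A \<pi>"
    and w: "(\<Sum>x\<in>UNIV. w $ x) = 0"
  defines "c \<equiv> w v* matrix_inv (rank_one_matrix \<pi> - A)"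
  shows "(\<Sum>x\<in>UNIV. c $ x) = 0" and "c v* A = - w"
proof -
  have eq: "c v* (rank_one_matrix \<pi> - A) = w"
    unfolding c_def vector_matrix_mul_assoc
    using someI_ex[OF invertible_fundamental_matrix[OF A st, unfolded invertible_def]]
    by (simp add: matrix_inv_def)
  have "(rank_one_matrix \<pi> - A) *v 1 = 1"
    by (simp add: matrix_vector_mult_diff_rdistrib rank_one_matrix_mult_vec
        rate_matrix_mult_one[OF A(1)] inner_one_right sum_pmf_UNIV)
  then have "c \<bullet> 1 = w \<bullet> 1" by (metis eq dot_lmul_matrix)
  then show c: "(\<Sum>x\<in>UNIV. c $ x) = 0" using w by (simp add: inner_one_right)
  have "c v* rank_one_matrix \<pi> = 0"
    using c by (simp add: vec_eq_iff vector_matrix_mult_nth rank_one_matrix_def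
        sum_distrib_right[symmetric])
  with eq show "c v* A = - w"
    by (auto simp: vector_matrix_mult_diff_rdistrib)
qed

section \<open>The perturbed forward equation\<close>

lemma row_sum_le_matrix_norm: "(\<Sum>y\<in>UNIV. \<bar>A $ x $ y\<bar>) \<le> matrix_norm A"
  unfolding matrix_norm_def by (rule Max_ge) auto

lemma norm_prob_vector_le_one:
  fixes v :: "real^'s::finite"
  assumes "\<And>x. 0 \<le> v $ x" "(\<Sum>x\<in>UNIV. v $ x) = 1"
  shows "norm v \<le> 1"
  using norm_le_l1_cart[of v] assms by simp

text \<open>The product is a convex combination of the rows of \<open>A\<close>, each of which has
  sum of absolute values at most \<open>matrix_norm A\<close>; the Euclidean norm is bounded by that
  sum.\<close>

lemma norm_prob_vector_mult_le:
  fixes v :: "real^'s::finite"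
  assumes "\<And>x. 0 \<le> v $ x" "(\<Sum>x\<in>UNIV. v $ x) = 1"
  shows "norm (v v* A) \<le> matrix_norm A"
proof -
  have "norm (v v* A) \<le> (\<Sum>y\<in>UNIV. \<bar>\<Sum>x\<in>UNIV. v $ x * A $ x $ y\<bar>)"
    using norm_le_l1_cart[of "v v* A"] by (simp add: vector_matrix_mult_nth)
  also have "\<dots> \<le> (\<Sum>y\<in>UNIV. \<Sum>x\<in>UNIV. v $ x * \<bar>A $ x $ y\<bar>)"
    using assms(1) by (intro sum_mono order_trans[OF sum_abs]) (simp add: abs_mult)
  also have "\<dots> = (\<Sum>x\<in>UNIV. v $ x * (\<Sum>y\<in>UNIV. \<bar>A $ x $ y\<bar>))"
    by (subst sum.swap) (simp add: sum_distrib_left)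
  also have "\<dots> \<le> (\<Sum>x\<in>UNIV. v $ x * matrix_norm A)"
    using assms(1) by (intro sum_mono mult_left_mono row_sum_le_matrix_norm)
  finally show ?thesis by (simp add: sum_distrib_right[symmetric] assms(2))
qed

text \<open>The central estimate. The constants are fixed before \<epsilon>, \<open>S\<close>,
  \<open>T\<close>, \<open>p\<close> and \<open>Q\<close> are quantified, so the bound is uniform in
  them. The condition \<open>\<epsilon> * S \<le> \<eta>\<close> keeps the drift
  \<open>\<epsilon> * u * B\<close> weak enough to be absorbed by the dissipation of
  \<open>A\<close>.\<close>

lemma perturbed_forward_equation:
  fixes A B :: "real^'s::finite^'s" and a b :: "real^'s" and C :: real
  assumes A: "rate_matrix A" "irreducible_matrix A" and st: "stationary_distribution A \<pi>"
    and bA: "b v* A = - (row_of_pmf \<pi> v* B)" and aA: "a v* A = - b"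
    and sums: "(\<Sum>x\<in>UNIV. a $ x) = 0" "(\<Sum>x\<in>UNIV. b $ x) = 0"
    and "0 \<le> C"
  obtains c K \<eta> where "c > 0" "K \<ge> 0" "\<eta> > 0"
    and "\<And>\<epsilon> S T p Q. 0 < \<epsilon> \<Longrightarrow> 1 \<le> S \<Longrightarrow> \<epsilon> * S \<le> \<eta> \<Longrightarrow>
      (\<And>v x. T - S \<le> v \<Longrightarrow> v \<le> T \<Longrightarrow> 0 \<le> p v $ x) \<Longrightarrow>
      (\<And>v. T - S \<le> v \<Longrightarrow> v \<le> T \<Longrightarrow> (\<Sum>x\<in>UNIV. p v $ x) = 1) \<Longrightarrow>
      (\<And>x. continuous_on {T - S..T} (\<lambda>v. p v $ x)) \<Longrightarrow>
      (\<And>v x. T - S \<le> v \<Longrightarrow> v < T \<Longrightarrow>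
        ((\<lambda>v. p v $ x) has_real_derivative (p v v* Q v) $ x) (at_right v)) \<Longrightarrow>
      (\<And>u. 0 \<le> u \<Longrightarrow> u \<le> S \<Longrightarrow>
        matrix_norm (Q (T - u) - (A - (\<epsilon> * u) *\<^sub>R B)) \<le> C * (\<epsilon>\<^sup>2 * S\<^sup>2)) \<Longrightarrow>
      (norm (p T - (row_of_pmf \<pi> - \<epsilon> *\<^sub>R a)))\<^sup>2 \<le> K * (exp (- c * S) + (\<epsilon>\<^sup>2 * S\<^sup>2)\<^sup>2)"
proof -
  obtain \<gamma> where \<gamma>: "\<gamma> > 0"
    "\<And>d. (\<Sum>x\<in>UNIV. d $ x) = 0 \<Longrightarrow>
      (\<Sum>y\<in>UNIV. (d v* A) $ y * d $ y / pmf \<pi> y) \<le> - \<gamma> * (norm d)\<^sup>2"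
    using weighted_form_coercive[OF A st] by blast
  have pos: "0 < pmf \<pi> x" for x by (rule irreducible_stationary_pos[OF A st])
  define L where "L = (\<Sum>x\<in>UNIV. 1 / pmf \<pi> x)"
  have "L > 0" unfolding L_def using pos by (intro sum_pos) auto
  have form_le: "(\<Sum>x\<in>UNIV. e $ x * d $ x / pmf \<pi> x) \<le> L * (norm e * norm d)" for d e :: "real^'s"
    unfolding L_def sum_distrib_right
  proof (rule sum_mono)
    fix x
    have "e $ x * d $ x \<le> norm e * norm d"
      using mult_mono[OF component_le_norm_cart[of e x] component_le_norm_cart[of d x]]
      by (simp flip: abs_mult)
    then show "e $ x * d $ x / pmf \<pi> x \<le> 1 / pmf \<pi> x * (norm e * norm d)"
      using pos[of x] by (simp add: divide_right_mono)
  qed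
  \<comment> \<open>The Lyapunov function. Along \<open>d' = d A\<close> its derivative is twice the
    coercive form; it lies between the squared Euclidean norm and \<open>L\<close> times it, because
    \<pi> is at most 1.\<close>
  define N where "N d = (\<Sum>x\<in>UNIV. (d $ x)\<^sup>2 / pmf \<pi> x)" for d :: "real^'s"
  have N_le: "N d \<le> L * (norm d)\<^sup>2" for d
    using form_le[of d d] by (simp add: N_def power2_eq_square)
  have N_ge: "(norm d)\<^sup>2 \<le> N d" for d
  proof -
    have "(norm d)\<^sup>2 = (\<Sum>x\<in>UNIV. (d $ x)\<^sup>2)"
      unfolding power2_norm_eq_inner by (simp add: inner_vec_def power2_eq_square)
    also have "\<dots> \<le> N d"
      unfolding N_def using pos
      by (intro sum_mono) (simp add: pos_le_divide_eq mult_left_le pmf_le_1)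
    finally show ?thesis .
  qed
  obtain \<kappa> where \<kappa>: "\<kappa> > 0" "\<And>d. norm (d v* B) \<le> norm d * \<kappa>"
    using bounded_linear.pos_bounded[OF matrix_vector_mul_bounded_linear[of "transpose B"]]
    by auto
  \<comment> \<open>Collects the sources of error of size
    \<open>\<epsilon>\<^sup>2 * S\<^sup>2\<close>: the approximation of \<open>Q\<close> and the two
    second-order terms produced by \<open>B\<close> acting on \<open>a\<close> and
    \<open>b\<close>.\<close>
  define C' where "C' = C + norm (a v* B) + norm (b v* B)"
  have "C' \<ge> 0" using \<open>0 \<le> C\<close> by (simp add: C'_def)
  \<comment> \<open>With this choice \<open>2 * L * \<eta> * \<kappa> = \<gamma>\<close>, so the
    drift consumes half of the dissipation \<open>2 * \<gamma>\<close>.\<close>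
  define \<eta> where "\<eta> = \<gamma> / (2 * L * \<kappa>)"
  have "\<eta> > 0" using \<open>\<gamma> > 0\<close> \<open>L > 0\<close> \<kappa>(1) by (simp add: \<eta>_def)
  \<comment> \<open>Half of the remaining \<gamma> goes into Young's inequality below; the other
    half, \<open>\<gamma> / 2\<close>, is turned into a decay rate for \<open>N\<close> through
    \<open>N_le\<close>.\<close>
  define c where "c = \<gamma> / (2 * L)"
  have "c > 0" using \<open>\<gamma> > 0\<close> \<open>L > 0\<close> by (simp add: c_def)
  define K0 where "K0 = 2 * L\<^sup>2 * C'\<^sup>2 / \<gamma>"
  have "K0 \<ge> 0" using \<open>\<gamma> > 0\<close> by (simp add: K0_def)
  define K1 where "K1 = L * (2 + \<eta> * (norm a + norm b))\<^sup>2"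
  have "K1 \<ge> 0" using \<open>L > 0\<close> by (simp add: K1_def)
  show ?thesis
  proof (rule that[OF \<open>c > 0\<close> _ \<open>\<eta> > 0\<close>])
    show "K1 + K0 / c \<ge> 0" using \<open>K1 \<ge> 0\<close> \<open>K0 \<ge> 0\<close> \<open>c > 0\<close> by simp
    fix \<epsilon> S T :: real and p :: "real \<Rightarrow> real^'s" and Q :: "real \<Rightarrow> real^'s^'s"
    assume \<epsilon>: "0 < \<epsilon>" and S: "1 \<le> S" and \<epsilon>S: "\<epsilon> * S \<le> \<eta>"
      and p0: "\<And>v x. T - S \<le> v \<Longrightarrow> v \<le> T \<Longrightarrow> 0 \<le> p v $ x"
      and p1: "\<And>v. T - S \<le> v \<Longrightarrow> v \<le> T \<Longrightarrow> (\<Sum>x\<in>UNIV. p v $ x) = 1"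
      and cont: "\<And>x. continuous_on {T - S..T} (\<lambda>v. p v $ x)"
      and deriv: "\<And>v x. T - S \<le> v \<Longrightarrow> v < T \<Longrightarrow>
        ((\<lambda>v. p v $ x) has_real_derivative (p v v* Q v) $ x) (at_right v)"
      and Q: "\<And>u. 0 \<le> u \<Longrightarrow> u \<le> S \<Longrightarrow>
        matrix_norm (Q (T - u) - (A - (\<epsilon> * u) *\<^sub>R B)) \<le> C * (\<epsilon>\<^sup>2 * S\<^sup>2)"
    define d where "d v = p v - (row_of_pmf \<pi> - \<epsilon> *\<^sub>R (a + (T - v) *\<^sub>R b))" for v
    \<comment> \<open>The right derivative of \<open>d\<close>; the term in \<open>b\<close> comes
      from differentiating \<open>T - v\<close>. The residual \<open>R\<close> below is what
      separates it from the unperturbed flow.\<close>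
    define D where "D v = p v v* Q v - \<epsilon> *\<^sub>R b" for v
    define R where "R v = D v - d v v* A" for v
    have d_sum: "(\<Sum>x\<in>UNIV. d v $ x) = 0" if "T - S \<le> v" "v \<le> T" for v
      by (simp add: d_def sum.distrib sum_subtractf sum_distrib_left[symmetric] p1[OF that] sums
          sum_pmf_UNIV)
    have R_le: "norm (R v) \<le> C' * (\<epsilon>\<^sup>2 * S\<^sup>2) + \<eta> * \<kappa> * norm (d v)" if v: "T - S \<le> v" "v < T" for v
    proof -
      define u where "u = T - v"
      \<comment> \<open>The bound of \<open>u\<close> by the square of \<open>S\<close> uses
        \<open>1 \<le> S\<close>; it puts both second-order terms on one scale.\<close>
      have u: "0 \<le> u" "u \<le> S" "u \<le> S\<^sup>2" "u * u \<le> S\<^sup>2"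
        using v S unfolding u_def
        by (auto simp: power2_eq_square intro: mult_mono order_trans[OF _ mult_left_mono[of 1 S S]])
      let ?E = "Q (T - u) - (A - (\<epsilon> * u) *\<^sub>R B)"
      have \<pi>A: "row_of_pmf \<pi> v* A = 0" using st by (simp add: stationary_distribution_def)
      have p_eq: "p v = d v + row_of_pmf \<pi> - \<epsilon> *\<^sub>R (a + u *\<^sub>R b)" by (simp add: d_def u_def)
      have pQ: "p v v* Q v = p v v* ?E + p v v* A - (\<epsilon> * u) *\<^sub>R (p v v* B)"
        by (simp add: u_def vector_matrix_mult_diff_rdistrib vector_scaleR_matrix_ac)
      have pA: "p v v* A = d v v* A + \<epsilon> *\<^sub>R (b + u *\<^sub>R (row_of_pmf \<pi> v* B))"
        by (simp add: p_eq vector_matrix_left_distrib vector_matrix_mult_diff_distrib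
            scaleR_vector_matrix_assoc \<pi>A aA bA algebra_simps)
      have pB: "p v v* B = d v v* B + row_of_pmf \<pi> v* B - \<epsilon> *\<^sub>R (a v* B + u *\<^sub>R (b v* B))"
        by (simp add: p_eq vector_matrix_left_distrib vector_matrix_mult_diff_distrib
            scaleR_vector_matrix_assoc)
      \<comment> \<open>All first-order terms cancel: \<open>\<epsilon> *\<^sub>R b\<close> between
        \<open>D\<close> and \<open>pA\<close>, and the multiple of \<open>\<pi> B\<close> between
        \<open>pA\<close> and \<open>pB\<close>. This is what the equations for \<open>a\<close> and
        \<open>b\<close> were chosen for.\<close>
      have "R v = p v v* ?E - (\<epsilon> * u) *\<^sub>R (d v v* B) + (\<epsilon>\<^sup>2 * u) *\<^sub>R (a v* B)
          + (\<epsilon>\<^sup>2 * (u * u)) *\<^sub>R (b v* B)"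
        unfolding R_def D_def pQ unfolding pA pB by (simp add: algebra_simps power2_eq_square)
      also have "norm \<dots> \<le> norm (p v v* ?E) + (\<epsilon> * u) * norm (d v v* B) + (\<epsilon>\<^sup>2 * u) * norm (a v* B)
          + (\<epsilon>\<^sup>2 * (u * u)) * norm (b v* B)"
      proof -
        have "norm (e - x + y + z) \<le> norm e + norm x + norm y + norm z" for e x y z :: "real^'s"
          by norm
        from this[of "p v v* ?E" "(\<epsilon> * u) *\<^sub>R (d v v* B)" "(\<epsilon>\<^sup>2 * u) *\<^sub>R (a v* B)"
            "(\<epsilon>\<^sup>2 * (u * u)) *\<^sub>R (b v* B)"]
        show ?thesis using \<epsilon> u(1) by (simp add: abs_mult)
      qed
      also have "\<dots> \<le> C * (\<epsilon>\<^sup>2 * S\<^sup>2) + \<eta> * (norm (d v) * \<kappa>) + (\<epsilon>\<^sup>2 * S\<^sup>2) * norm (a v* B)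
          + (\<epsilon>\<^sup>2 * S\<^sup>2) * norm (b v* B)"
      proof (intro add_mono)
        show "norm (p v v* ?E) \<le> C * (\<epsilon>\<^sup>2 * S\<^sup>2)"
          using norm_prob_vector_mult_le[of "p v" ?E] p0[of v] p1[of v] Q[OF u(1,2)] v by auto
        have "\<epsilon> * u \<le> \<eta>" using mult_left_mono[OF u(2), of \<epsilon>] \<epsilon>S \<epsilon> by linarith
        then show "\<epsilon> * u * norm (d v v* B) \<le> \<eta> * (norm (d v) * \<kappa>)"
          using \<epsilon> u \<eta>_def \<open>\<eta> > 0\<close> \<kappa>(2) by (intro mult_mono) auto
      qed (use u \<epsilon> in \<open>(intro mult_right_mono mult_left_mono; simp)+\<close>)
      finally show ?thesis by (simp add: C'_def algebra_simps)
    qed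
    have "N (d T) \<le> exp (- c * (T - (T - S))) * N (d (T - S)) + K0 * (\<epsilon>\<^sup>2 * S\<^sup>2)\<^sup>2 / c"
    proof (rule right_derivative_exponential_decay[OF _ _ _ _ \<open>c > 0\<close>])
      show "T - S \<le> T" using S by simp
      show "continuous_on {T - S..T} (\<lambda>v. N (d v))"
        unfolding N_def d_def using pos
        by (auto intro!: continuous_intros cont simp: less_imp_neq[THEN not_sym])
      show "0 \<le> K0 * (\<epsilon>\<^sup>2 * S\<^sup>2)\<^sup>2" using \<open>K0 \<ge> 0\<close> by simp
      fix v assume v: "T - S \<le> v" "v < T"
      have d_deriv: "((\<lambda>v. d v $ x) has_real_derivative D v $ x) (at_right v)" for x
        using deriv[OF v, of x] unfolding d_def D_def
        by (auto intro!: derivative_eq_intros simp: algebra_simps)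
      have "((\<lambda>v. (d v $ x)\<^sup>2 / pmf \<pi> x) has_real_derivative
          2 * (D v $ x * d v $ x / pmf \<pi> x)) (at_right v)" for x
        using DERIV_cdivide[OF DERIV_power[OF d_deriv, where n = 2], where c = "pmf \<pi> x"] by (simp add: mult_ac)
      then show "((\<lambda>v. N (d v)) has_real_derivative
          (\<Sum>x\<in>UNIV. 2 * (D v $ x * d v $ x / pmf \<pi> x))) (at_right v)"
        unfolding N_def by (intro DERIV_sum)
      let ?n = "norm (d v)" and ?e = "\<epsilon>\<^sup>2 * S\<^sup>2"
      have "D v = d v v* A + R v" by (simp add: R_def)
      then have "(\<Sum>x\<in>UNIV. 2 * (D v $ x * d v $ x / pmf \<pi> x)) =
          2 * (\<Sum>x\<in>UNIV. (d v v* A) $ x * d v $ x / pmf \<pi> x) +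
          2 * (\<Sum>x\<in>UNIV. R v $ x * d v $ x / pmf \<pi> x)"
        by (simp add: sum_distrib_left sum.distrib[symmetric] distrib_right add_divide_distrib)
      also have "\<dots> \<le> 2 * (- \<gamma> * ?n\<^sup>2) + 2 * (L * ((C' * ?e + \<eta> * \<kappa> * ?n) * ?n))"
        using v \<open>L > 0\<close>
        by (intro add_mono mult_left_mono \<gamma>(2) d_sum order_trans[OF form_le] mult_right_mono R_le) auto
      also have "\<dots> = - \<gamma> * ?n\<^sup>2 + 2 * (L * C' * ?e) * ?n"
        using \<open>L > 0\<close> \<kappa>(1) by (simp add: \<eta>_def field_simps power2_eq_square)
      \<comment> \<open>Young's inequality, obtained by completing a square; \<open>K0\<close> is
        the constant it leaves.\<close>
      also have "2 * (L * C' * ?e) * ?n \<le> \<gamma> / 2 * ?n\<^sup>2 + K0 * ?e\<^sup>2"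
      proof -
        have "0 \<le> (\<gamma> * ?n - 2 * (L * C' * ?e))\<^sup>2 / (2 * \<gamma>)" using \<open>\<gamma> > 0\<close> by simp
        also have "\<dots> = \<gamma> / 2 * ?n\<^sup>2 + K0 * ?e\<^sup>2 - 2 * (L * C' * ?e) * ?n"
          using \<open>\<gamma> > 0\<close> by (simp add: K0_def field_simps power2_eq_square)
        finally show ?thesis by simp
      qed
      also have "- \<gamma> * ?n\<^sup>2 + (\<gamma> / 2 * ?n\<^sup>2 + K0 * ?e\<^sup>2) = - c * (L * ?n\<^sup>2) + K0 * ?e\<^sup>2"
        using \<open>L > 0\<close> by (simp add: c_def field_simps)
      also have "\<dots> \<le> - c * N (d v) + K0 * ?e\<^sup>2"
        using N_le[of "d v"] \<open>c > 0\<close> by simp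
      finally show "(\<Sum>x\<in>UNIV. 2 * (D v $ x * d v $ x / pmf \<pi> x)) \<le> - c * N (d v) + K0 * ?e\<^sup>2"
        by simp
    qed
    \<comment> \<open>At the start of the window the difference is merely bounded: two probability
      vectors, and corrections controlled by
      \<open>\<epsilon> \<le> \<epsilon> * S \<le> \<eta>\<close>.\<close>
    moreover have "N (d (T - S)) \<le> K1"
    proof -
      have "norm (d (T - S)) \<le> norm (p (T - S)) + norm (row_of_pmf \<pi>) + norm (\<epsilon> *\<^sub>R a) + norm ((\<epsilon> * S) *\<^sub>R b)"
      proof -
        have "norm (e - (x - (y + z))) \<le> norm e + norm x + norm y + norm z" for e x y z :: "real^'s"
          by norm
        from this[of "p (T - S)" "row_of_pmf \<pi>" "\<epsilon> *\<^sub>R a" "(\<epsilon> * S) *\<^sub>R b"]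
        show ?thesis by (simp add: d_def scaleR_add_right)
      qed
      also have "\<dots> \<le> 1 + 1 + \<eta> * norm a + \<eta> * norm b"
      proof (intro add_mono)
        show "norm (p (T - S)) \<le> 1" using S by (intro norm_prob_vector_le_one p0 p1) auto
        show "norm (row_of_pmf \<pi>) \<le> 1" by (intro norm_prob_vector_le_one) (auto simp: sum_pmf_UNIV)
        have "\<epsilon> \<le> \<eta>" using mult_left_mono[OF S, of \<epsilon>] \<epsilon>S \<epsilon> by linarith
        then show "norm (\<epsilon> *\<^sub>R a) \<le> \<eta> * norm a" using \<epsilon> by (simp add: mult_right_mono)
        show "norm ((\<epsilon> * S) *\<^sub>R b) \<le> \<eta> * norm b" using \<epsilon>S \<epsilon> S by (simp add: mult_right_mono)
      qed
      finally have "norm (d (T - S)) \<le> 2 + \<eta> * (norm a + norm b)" by (simp add: algebra_simps)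
      then have "L * (norm (d (T - S)))\<^sup>2 \<le> K1"
        unfolding K1_def using \<open>L > 0\<close> by (intro mult_left_mono power_mono) auto
      with N_le show ?thesis by (rule order_trans)
    qed
    ultimately have "N (d T) \<le> exp (- c * S) * K1 + K0 * (\<epsilon>\<^sup>2 * S\<^sup>2)\<^sup>2 / c"
      by (auto intro: order_trans add_mono mult_left_mono)
    also have "\<dots> \<le> (K1 + K0 / c) * (exp (- c * S) + (\<epsilon>\<^sup>2 * S\<^sup>2)\<^sup>2)"
    proof -
      have "0 \<le> K0 / c * exp (- c * S)" "0 \<le> K1 * (\<epsilon>\<^sup>2 * S\<^sup>2)\<^sup>2"
        using \<open>K1 \<ge> 0\<close> \<open>K0 \<ge> 0\<close> \<open>c > 0\<close> by simp_all
      then show ?thesis by (simp add: algebra_simps)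
    qed
    finally show "(norm (p T - (row_of_pmf \<pi> - \<epsilon> *\<^sub>R a)))\<^sup>2 \<le>
        (K1 + K0 / c) * (exp (- c * S) + (\<epsilon>\<^sup>2 * S\<^sup>2)\<^sup>2)"
      using N_ge[of "d T"] by (simp add: d_def)
  qed
qed

section \<open>Transition matrices of the jump process\<close>

context markov_jump_process
begin

section \<open>Expectations of the process and the Chapman-Kolmogorov equation\<close>

lemma subalgebra_natural:
  assumes "0 \<le> s"
  shows "subalgebra (M s x) (natural_sigma_algebra (M s x) X s u)"
proof -
  let ?G = "{X v -` A \<inter> space (M s x) | v A. s \<le> v \<and> v \<le> u}"
  have "?G \<subseteq> sets (M s x)"
    using measurable_sets[OF measurable[OF assms]] by fastforce
  then have "sigma_sets (space (M s x)) ?G \<subseteq> sets (M s x)"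
    by (rule sets.sigma_sets_subset)
  moreover have "?G \<subseteq> Pow (space (M s x))" by blast
  ultimately show ?thesis
    unfolding natural_sigma_algebra_def subalgebra_def by simp
qed

lemma integrable_state:
  assumes "0 \<le> s" "s \<le> v"
  shows "integrable (M s x) (\<lambda>\<omega>. (g :: 's \<Rightarrow> real) (X v \<omega>))"
proof -
  interpret prob_space "M s x" using assms(1) by (rule prob_space)
  have "X v \<in> measurable (M s x) (count_space UNIV)" using measurable assms by blast
  then have "(\<lambda>\<omega>. g (X v \<omega>)) \<in> borel_measurable (M s x)"
    by (rule measurable_compose) simp
  then show ?thesis
    by (rule integrable_const_bound[where B = "Max (range (\<lambda>y. \<bar>g y\<bar>))", rotated]) simp
qed

lemma transition_matrix_mult_vec:
  assumes "0 \<le> s" "s \<le> v"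
  shows "(transition_matrix M X s v *v f) $ x = (\<integral>\<omega>. f $ X v \<omega> \<partial>M s x)"
proof -
  interpret prob_space "M s x" using assms(1) by (rule prob_space)
  have meas: "{\<omega> \<in> space (M s x). X v \<omega> = y} \<in> sets (M s x)" for y
    using measurable_sets[OF measurable[OF assms], of "{y}" x]
    by (simp add: vimage_def Int_def conj_commute)
  have "(\<integral>\<omega>. f $ X v \<omega> \<partial>M s x) =
      (\<integral>\<omega>. (\<Sum>y\<in>UNIV. indicat_real {\<omega> \<in> space (M s x). X v \<omega> = y} \<omega> * f $ y) \<partial>M s x)"
    by (rule Bochner_Integration.integral_cong) (auto simp: indicator_def if_distrib cong: if_cong)
  also have "\<dots> = (\<Sum>y\<in>UNIV. measure (M s x) {\<omega> \<in> space (M s x). X v \<omega> = y} * f $ y)"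
    using meas by (subst Bochner_Integration.integral_sum) (auto simp: emeasure_eq_measure)
  finally show ?thesis
    by (simp add: matrix_vector_mult_def transition_matrix_def)
qed

text \<open>Taking expectations in \<open>markov\<close> removes the conditioning by the tower
  property; as this holds for every \<open>f\<close>, the matrices agree.\<close>

lemma chapman_kolmogorov:
  assumes "0 \<le> s" "s \<le> u" "u \<le> v"
  shows "transition_matrix M X s v = transition_matrix M X s u ** transition_matrix M X u v"
proof -
  have "transition_matrix M X s v *v f = transition_matrix M X s u *v (transition_matrix M X u v *v f)"
    for f
  proof (rule vec_eq_iff[THEN iffD2, rule_format])
    fix x
    interpret prob_space "M s x" using assms(1) by (rule prob_space)
    interpret finite_measure_subalgebra "M s x" "natural_sigma_algebra (M s x) X s u"
      by unfold_locales (rule subalgebra_natural[OF assms(1)])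
    have int: "integrable (M s x) (\<lambda>\<omega>. f $ X v \<omega>)"
      using assms by (intro integrable_state[where g = "\<lambda>y. f $ y"]) auto
    have "(\<integral>\<omega>. f $ X v \<omega> \<partial>M s x) =
        (\<integral>\<omega>. real_cond_exp (M s x) (natural_sigma_algebra (M s x) X s u) (\<lambda>\<omega>. f $ X v \<omega>) \<omega> \<partial>M s x)"
      using real_cond_exp_int(2)[OF int] by simp
    also have "\<dots> = (\<integral>\<omega>. (transition_matrix M X u v *v f) $ X u \<omega> \<partial>M s x)"
      using markov[OF assms, of x f] integrable_state[OF assms(1,2)]
      by (intro integral_cong_AE borel_measurable_integrable real_cond_exp_int(1)[OF int]) auto
    finally show "(transition_matrix M X s v *v f) $ x =
        (transition_matrix M X s u *v (transition_matrix M X u v *v f)) $ x"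
      using assms by (simp add: transition_matrix_mult_vec)
  qed
  then show ?thesis
    by (simp add: matrix_eq matrix_vector_mul_assoc)
qed

section \<open>Stochasticity, right derivatives and continuity of the transition matrices\<close>

lemma transition_matrix_nonneg: "0 \<le> transition_matrix M X s v $ x $ y"
  by (simp add: transition_matrix_def)

lemma transition_matrix_row_sum:
  assumes "0 \<le> s" "s \<le> v"
  shows "(\<Sum>y\<in>UNIV. transition_matrix M X s v $ x $ y) = 1"
proof -
  interpret prob_space "M s x" using assms(1) by (rule prob_space)
  show ?thesis
    using transition_matrix_mult_vec[OF assms, of 1 x]
    by (simp add: matrix_vector_mult_def prob_space)
qed

lemma transition_matrix_refl_mult_vec:
  assumes "0 \<le> s"
  shows "(transition_matrix M X s s *v f) $ x = f $ x"
proof -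
  interpret prob_space "M s x" using assms(1) by (rule prob_space)
  have "(\<integral>\<omega>. f $ X s \<omega> \<partial>M s x) = (\<integral>\<omega>. f $ x \<partial>M s x)"
    using start[OF assms, of x] integrable_state[OF assms order_refl, of x "\<lambda>y. f $ y"]
    by (intro integral_cong_AE) auto
  then show ?thesis
    using transition_matrix_mult_vec[OF assms order_refl] by (simp add: prob_space)
qed

text \<open>For \<open>t = s\<close> the conditional expectation in \<open>rates\<close> is almost surely the constant
  \<open>(transition_matrix M X s (s + h) *v f) $ x\<close>, but with an exceptional set that depends on \<open>h\<close>.
  Along a sequence of increments there is a common exceptional set.\<close>

lemma transition_matrix_has_derivative_diagonal:
  assumes "0 \<le> s"
  shows "((\<lambda>v. (transition_matrix M X s v *v f) $ x) has_real_derivative (Q s *v f) $ x) (at_right s)"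
  unfolding has_field_derivative_iff tendsto_at_iff_sequentially
proof (intro allI impI)
  fix Y :: "nat \<Rightarrow> real"
  assume Y: "\<forall>i. Y i \<in> {s<..} - {s}" "Y \<longlonglongrightarrow> s"
  interpret prob_space "M s x" using assms(1) by (rule prob_space)
  define h where "h i = Y i - s" for i
  have h: "h i > 0" for i using Y by (simp add: h_def)
  have h0: "filterlim h (at_right 0) sequentially"
    using h Y(2) by (auto simp: filterlim_at h_def[abs_def] LIM_zero_iff less_imp_neq[THEN not_sym])
  obtain g where g1: "\<And>h. h > 0 \<Longrightarrow> AE \<omega> in M s x. real_cond_exp (M s x)
        (natural_sigma_algebra (M s x) X s s) (\<lambda>\<omega>. f $ X (s + h) \<omega>) \<omega> = g h \<omega>"
    and g2: "AE \<omega> in M s x.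
        (\<lambda>h. g h \<omega> - (f $ X s \<omega> + (Q s *v f) $ X s \<omega> * h)) \<in> o[at_right 0](\<lambda>h. h)"
    using rates[OF assms order_refl, of x f] by blast
  have "AE \<omega> in M s x. \<forall>i. g (h i) \<omega> = (transition_matrix M X s (Y i) *v f) $ x"
  proof (subst AE_all_countable, rule allI)
    fix i
    have "AE \<omega> in M s x. real_cond_exp (M s x)
        (natural_sigma_algebra (M s x) X s s) (\<lambda>\<omega>. f $ X (s + h i) \<omega>) \<omega> =
        (transition_matrix M X s (s + h i) *v f) $ X s \<omega>"
      using h[of i] assms by (intro markov) auto
    with g1[OF h[of i]] start[OF assms, of x]
    show "AE \<omega> in M s x. g (h i) \<omega> = (transition_matrix M X s (Y i) *v f) $ x"
      by eventually_elim (simp add: h_def)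
  qed
  with g2 start[OF assms, of x]
  have "AE \<omega> in M s x. (\<forall>i. g (h i) \<omega> = (transition_matrix M X s (Y i) *v f) $ x) \<and>
     (\<lambda>h. g h \<omega> - (f $ x + (Q s *v f) $ x * h)) \<in> o[at_right 0](\<lambda>h. h)"
    by eventually_elim simp
  \<comment> \<open>Once \<open>g (h i)\<close> is replaced by transition probabilities, the limit
    is a deterministic statement, so one outcome outside the null set suffices.\<close>
  then have "\<exists>\<omega>. (\<forall>i. g (h i) \<omega> = (transition_matrix M X s (Y i) *v f) $ x) \<and>
     (\<lambda>h. g h \<omega> - (f $ x + (Q s *v f) $ x * h)) \<in> o[at_right 0](\<lambda>h. h)"
    by (rule eventually_happens'[rotated]) (simp add: trivial_limit_def AE_False)
  then obtain \<omega> where w: "\<And>i. g (h i) \<omega> = (transition_matrix M X s (Y i) *v f) $ x"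
      "(\<lambda>h. g h \<omega> - (f $ x + (Q s *v f) $ x * h)) \<in> o[at_right 0](\<lambda>h. h)"
    by blast
  have "((\<lambda>h. (g h \<omega> - (f $ x + (Q s *v f) $ x * h)) / h) \<longlongrightarrow> 0) (at_right 0)"
    by (rule smalloD_tendsto[OF w(2)])
  from filterlim_compose[OF this h0]
  have "(\<lambda>i. (g (h i) \<omega> - (f $ x + (Q s *v f) $ x * h i)) / h i + (Q s *v f) $ x)
      \<longlonglongrightarrow> 0 + (Q s *v f) $ x"
    by (intro tendsto_add tendsto_const)
  moreover have "(g (h i) \<omega> - (f $ x + (Q s *v f) $ x * h i)) / h i + (Q s *v f) $ x =
      ((transition_matrix M X s (Y i) *v f) $ x - (transition_matrix M X s s *v f) $ x) / (Y i - s)" for i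
    using h[of i] w(1)[of i] transition_matrix_refl_mult_vec[OF assms, of f x]
    by (simp add: h_def field_simps)
  ultimately show "((\<lambda>y. ((transition_matrix M X s y *v f) $ x - (transition_matrix M X s s *v f) $ x)
       / (y - s)) \<circ> Y) \<longlonglongrightarrow> (Q s *v f) $ x"
    by (simp add: o_def)
qed

text \<open>Kolmogorov's forward equation. To the right of \<open>u\<close>, Chapman-Kolmogorov
  factors out the fixed matrix from \<open>s\<close> to \<open>u\<close>, which leaves the
  derivative at the starting time \<open>u\<close>.\<close>

lemma transition_matrix_has_right_derivative:
  assumes "0 \<le> s" "s \<le> u"
  shows "((\<lambda>v. transition_matrix M X s v $ x $ y) has_real_derivative
     (transition_matrix M X s u ** Q u) $ x $ y) (at_right u)"
proof -
  have "((\<lambda>v. transition_matrix M X u v $ z $ y) has_real_derivative Q u $ z $ y) (at_right u)" for z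
    using transition_matrix_has_derivative_diagonal[of u "axis y 1" z] assms
    by (simp add: matrix_vector_mult_basis column_def)
  then have "((\<lambda>v. \<Sum>z\<in>UNIV. transition_matrix M X s u $ x $ z * transition_matrix M X u v $ z $ y)
      has_real_derivative (\<Sum>z\<in>UNIV. transition_matrix M X s u $ x $ z * Q u $ z $ y)) (at_right u)"
    by (intro DERIV_sum DERIV_cmult) auto
  moreover have "(\<Sum>z\<in>UNIV. transition_matrix M X s u $ x $ z * transition_matrix M X u v $ z $ y) =
      transition_matrix M X s v $ x $ y" if "u \<le> v" for v
    using chapman_kolmogorov[OF assms that] by (simp add: matrix_matrix_mult_def)
  ultimately show ?thesis
    by (auto simp: matrix_matrix_mult_def has_field_derivative_iff
        elim!: Lim_transform_eventually intro!: eventually_at_right_less[THEN eventually_mono])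
qed

text \<open>The right derivative says nothing about continuity from the left, which comes from
  \<open>no_fixed_jump\<close>. Along any sequence of times tending to \<open>v\<close> the state is
  almost surely eventually \<open>X v\<close>, and dominated convergence passes this to
  probabilities.\<close>

lemma continuous_on_transition_matrix:
  assumes "0 \<le> s"
  shows "continuous_on {s..} (\<lambda>v. transition_matrix M X s v $ x $ y)"
  unfolding continuous_on_eq_continuous_within
proof (intro ballI continuous_within_sequentiallyI)
  fix v and Y :: "nat \<Rightarrow> real"
  assume v: "v \<in> {s..}" and Y: "Y \<longlonglongrightarrow> v" "\<forall>n. Y n \<in> {s..}"
  interpret prob_space "M s x" using assms(1) by (rule prob_space)
  let ?i = "\<lambda>z. axis y 1 $ z :: real"
  have lim: "AE \<omega> in M s x. (\<lambda>n. ?i (X (Y n) \<omega>)) \<longlonglongrightarrow> ?i (X v \<omega>)"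
  proof -
    have "AE \<omega> in M s x. s < v \<longrightarrow> (\<forall>\<^sub>F u in at_left v. X u \<omega> = X v \<omega>)"
      using no_fixed_jump[OF assms, of v x] by (cases "s < v") auto
    with jump_paths[OF assms, of x] show ?thesis
    proof eventually_elim
      case (elim \<omega>)
      have "\<forall>\<^sub>F u in at_left v. s \<le> u \<longrightarrow> X u \<omega> = X v \<omega>"
      proof (cases "s < v")
        case True
        with elim show ?thesis by (auto elim: eventually_mono)
      next
        case False
        with v have "v = s" by simp
        then show ?thesis by (auto simp: eventually_at_filter)
      qed
      moreover have "\<forall>\<^sub>F u in at_right v. s \<le> u \<longrightarrow> X u \<omega> = X v \<omega>"
        using elim v by (auto elim: eventually_mono)
      ultimately have "\<forall>\<^sub>F u in nhds v. s \<le> u \<longrightarrow> X u \<omega> = X v \<omega>"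
        by (simp add: eventually_nhds_conv_at eventually_at_split)
      then have "\<forall>\<^sub>F n in sequentially. s \<le> Y n \<longrightarrow> X (Y n) \<omega> = X v \<omega>"
        using Y(1) by (rule eventually_compose_filterlim)
      then show ?case
        using Y(2) by (intro tendsto_eventually) (auto elim: eventually_mono)
    qed
  qed
  have "(\<lambda>n. \<integral>\<omega>. ?i (X (Y n) \<omega>) \<partial>M s x) \<longlonglongrightarrow> (\<integral>\<omega>. ?i (X v \<omega>) \<partial>M s x)"
    using Y(2) v lim
    by (intro integral_dominated_convergence[where w = "\<lambda>_. 1"] borel_measurable_integrable
        integrable_state[OF assms]) (auto simp: axis_def)
  then show "(\<lambda>n. transition_matrix M X s (Y n) $ x $ y) \<longlonglongrightarrow> transition_matrix M X s v $ x $ y"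
    using Y(2) v assms transition_matrix_mult_vec[OF assms, of _ "axis y 1" x, symmetric]
    by (simp add: matrix_vector_mult_basis column_def)
qed

section \<open>The marginal law of the process with initial law \<mu>\<close>

context
  fixes \<mu> :: "'s pmf" and p :: "real \<Rightarrow> real^'s"
  defines "p \<equiv> \<lambda>v. row_of_pmf \<mu> v* transition_matrix M X 0 v"
begin

lemma marginal_nonneg: "0 \<le> p v $ x"
  by (simp add: p_def vector_matrix_mult_nth sum_nonneg transition_matrix_nonneg)

lemma marginal_sum:
  assumes "0 \<le> v"
  shows "(\<Sum>x\<in>UNIV. p v $ x) = 1"
  unfolding p_def vector_matrix_mult_nth
  by (subst sum.swap)
     (simp add: sum_distrib_left[symmetric] transition_matrix_row_sum[OF order_refl assms] sum_pmf_UNIV)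

lemma continuous_on_marginal: "continuous_on {0..} (\<lambda>v. p v $ x)"
  unfolding p_def vector_matrix_mult_nth
  by (intro continuous_intros continuous_on_transition_matrix order_refl)

lemma marginal_has_right_derivative:
  assumes "0 \<le> v"
  shows "((\<lambda>v. p v $ x) has_real_derivative (p v v* Q v) $ x) (at_right v)"
proof -
  have "((\<lambda>v. p v $ x) has_real_derivative
      (\<Sum>z\<in>UNIV. row_of_pmf \<mu> $ z * (transition_matrix M X 0 v ** Q v) $ z $ x)) (at_right v)"
    unfolding p_def vector_matrix_mult_nth
    by (intro DERIV_sum DERIV_cmult transition_matrix_has_right_derivative assms order_refl)
  then show ?thesis
    unfolding p_def vector_matrix_mul_assoc by (simp add: vector_matrix_mult_nth)
qed

end

end

section \<open>The expansion\<close>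

text \<open>The exponent exceeding 1 makes \<open>exp (- c * s \<epsilon>)\<close> smaller than
  every power of \<epsilon>. The fourth power is the one needed, because the central estimate bounds
  a squared norm.\<close>

lemma log_power_asymptotics:
  fixes \<delta> c :: real
  assumes "0 < \<delta>" "0 < c"
  defines "s \<equiv> \<lambda>\<epsilon>. ln (1 / \<epsilon>) powr (1 + \<delta>)"
  shows "filterlim s at_top (at_right 0)"
    and "((\<lambda>\<epsilon>. \<epsilon> * s \<epsilon>) \<longlongrightarrow> 0) (at_right 0)"
    and "((\<lambda>\<epsilon>. exp (- c * s \<epsilon>) / \<epsilon> ^ 4) \<longlongrightarrow> 0) (at_right 0)"
  unfolding s_def using assms(1,2) by real_asymp+

theorem theorem9:
  fixes \<mu> :: "'s::finite pmf"
    and r :: "real^'s"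
    and Q :: "real \<Rightarrow> real \<Rightarrow> real^'s^'s"
    and M :: "real \<Rightarrow> real \<Rightarrow> 's \<Rightarrow> 'w measure"
    and X :: "real \<Rightarrow> real \<Rightarrow> 'w \<Rightarrow> 's"
    and P :: "real \<Rightarrow> real \<Rightarrow> real \<Rightarrow> real^'s^'s"
    and \<delta> :: real
    and s t :: "real \<Rightarrow> real"
    and Q0 Q1 :: "real^'s^'s"
    and \<pi> :: "'s pmf"
  assumes process: "\<And>\<epsilon>. 0 < \<epsilon> \<Longrightarrow> markov_jump_process (M \<epsilon>) (X \<epsilon>) (Q \<epsilon>)"
    and P: "\<And>\<epsilon> u v. 0 < \<epsilon> \<Longrightarrow> 0 \<le> u \<Longrightarrow> u \<le> v \<Longrightarrow> P \<epsilon> u v = transition_matrix (M \<epsilon>) (X \<epsilon>) u v"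
    and \<delta>: "0 < \<delta>"
    and s: "\<And>\<epsilon>. 0 < \<epsilon> \<Longrightarrow> s \<epsilon> = ln (1 / \<epsilon>) powr (1 + \<delta>)"
    and t: "filterlim (\<lambda>\<epsilon>. t \<epsilon> / s \<epsilon>) at_top (at_right 0)"
    and sup_finite: "\<forall>\<^sub>F \<epsilon> in at_right 0.
          bdd_above ((\<lambda>u. matrix_norm (Q \<epsilon> (t \<epsilon> - u) - (Q0 - (\<epsilon> * u) *\<^sub>R Q1))) ` {0..s \<epsilon>})"
    and sup_bound:
          "(\<lambda>\<epsilon>. SUP u\<in>{0..s \<epsilon>}. matrix_norm (Q \<epsilon> (t \<epsilon> - u) - (Q0 - (\<epsilon> * u) *\<^sub>R Q1)))
             \<in> O[at_right 0](\<lambda>\<epsilon>. \<epsilon>\<^sup>2 * (s \<epsilon>)\<^sup>2)"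
    and Q0: "rate_matrix Q0" "irreducible_matrix Q0"
    and \<pi>: "stationary_distribution Q0 \<pi>"
  shows "(\<lambda>\<epsilon>. (row_of_pmf \<mu> v* P \<epsilon> 0 (t \<epsilon>)) \<bullet> r -
              (row_of_pmf \<pi> \<bullet> r -
               \<epsilon> * ((row_of_pmf \<pi> v* Q1) \<bullet>
                     ((matrix_inv (rank_one_matrix \<pi> - Q0) ** matrix_inv (rank_one_matrix \<pi> - Q0)) *v r))))
           \<in> O[at_right 0](\<lambda>\<epsilon>. \<epsilon>\<^sup>2 * (s \<epsilon>) ^ 3)"
proof -
  have pos: "\<forall>\<^sub>F \<epsilon> :: real in at_right 0. 0 < \<epsilon>"
    by (rule eventually_at_right_less)
  have s_eq: "\<forall>\<^sub>F \<epsilon> in at_right 0. ln (1 / \<epsilon>) powr (1 + \<delta>) = s \<epsilon>"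
    using pos by eventually_elim (simp add: s)
  have s_at_top: "filterlim s at_top (at_right 0)"
    using log_power_asymptotics(1)[OF \<delta> zero_less_one] s_eq
    by (rule filterlim_cong[THEN iffD1, rotated -1, OF _ refl refl])
  have \<epsilon>s: "((\<lambda>\<epsilon>. \<epsilon> * s \<epsilon>) \<longlongrightarrow> 0) (at_right 0)"
    by (rule Lim_transform_eventually[OF log_power_asymptotics(2)[OF \<delta> zero_less_one]])
       (use s_eq in eventually_elim, simp)
  have s1: "\<forall>\<^sub>F \<epsilon> in at_right 0. 1 \<le> s \<epsilon>"
    using s_at_top by (simp add: filterlim_at_top)
  \<comment> \<open>Places the window from \<open>t - s\<close> to \<open>t\<close> within
    nonnegative times.\<close>
  have st: "\<forall>\<^sub>F \<epsilon> in at_right 0. s \<epsilon> \<le> t \<epsilon>"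
  proof -
    have "\<forall>\<^sub>F \<epsilon> in at_right 0. 1 \<le> t \<epsilon> / s \<epsilon>" using t by (simp add: filterlim_at_top)
    with s1 show ?thesis by eventually_elim (simp add: pos_le_divide_eq)
  qed
  obtain C where C: "C > 0" and C_bound: "\<forall>\<^sub>F \<epsilon> in at_right 0.
      norm (SUP u\<in>{0..s \<epsilon>}. matrix_norm (Q \<epsilon> (t \<epsilon> - u) - (Q0 - (\<epsilon> * u) *\<^sub>R Q1)))
        \<le> C * norm (\<epsilon>\<^sup>2 * (s \<epsilon>)\<^sup>2)"
    using sup_bound by (rule landau_o.bigE)
  have bound: "\<forall>\<^sub>F \<epsilon> in at_right 0. \<forall>u. 0 \<le> u \<and> u \<le> s \<epsilon> \<longrightarrow>
      matrix_norm (Q \<epsilon> (t \<epsilon> - u) - (Q0 - (\<epsilon> * u) *\<^sub>R Q1)) \<le> C * (\<epsilon>\<^sup>2 * (s \<epsilon>)\<^sup>2)"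
    using C_bound sup_finite
  proof eventually_elim
    case (elim \<epsilon>)
    show ?case
    proof (intro allI impI)
      fix u assume "0 \<le> u \<and> u \<le> s \<epsilon>"
      then have "matrix_norm (Q \<epsilon> (t \<epsilon> - u) - (Q0 - (\<epsilon> * u) *\<^sub>R Q1)) \<le>
          (SUP u\<in>{0..s \<epsilon>}. matrix_norm (Q \<epsilon> (t \<epsilon> - u) - (Q0 - (\<epsilon> * u) *\<^sub>R Q1)))"
        by (intro cSUP_upper elim(2)) simp
      also have "\<dots> \<le> C * (\<epsilon>\<^sup>2 * (s \<epsilon>)\<^sup>2)" using elim(1) by simp
      finally show "matrix_norm (Q \<epsilon> (t \<epsilon> - u) - (Q0 - (\<epsilon> * u) *\<^sub>R Q1)) \<le> C * (\<epsilon>\<^sup>2 * (s \<epsilon>)\<^sup>2)" .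
    qed
  qed

  \<comment> \<open>Forced by the expansion at \<open>u = s \<epsilon>\<close>: rows of
    \<open>Q\<close> and \<open>Q0\<close> sum to 0, so \<open>\<epsilon> * s \<epsilon>\<close>
    times the row sum of \<open>Q1\<close> is bounded by \<open>C\<close> times the square of
    \<open>\<epsilon> * s \<epsilon>\<close>. Dividing and letting \<epsilon> tend to 0 gives the
    claim.\<close>
  have Q1_row: "(\<Sum>y\<in>UNIV. Q1 $ x $ y) = 0" for x
  proof -
    let ?\<rho> = "\<Sum>y\<in>UNIV. Q1 $ x $ y"
    have "\<forall>\<^sub>F \<epsilon> in at_right 0. \<bar>?\<rho>\<bar> \<le> C * (\<epsilon> * s \<epsilon>)"
      using pos s1 st bound
    proof eventually_elim
      case (elim \<epsilon>)
      let ?E = "Q \<epsilon> (t \<epsilon> - s \<epsilon>) - (Q0 - (\<epsilon> * s \<epsilon>) *\<^sub>R Q1)"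
      have "rate_matrix (Q \<epsilon> (t \<epsilon> - s \<epsilon>))"
        using markov_jump_process.rate_matrix[OF process] elim by simp
      then have eq: "\<epsilon> * s \<epsilon> * ?\<rho> = (\<Sum>y\<in>UNIV. ?E $ x $ y)"
        using Q0(1) by (simp add: rate_matrix_def sum.distrib sum_subtractf sum_distrib_left)
      have "\<epsilon> * s \<epsilon> * \<bar>?\<rho>\<bar> = \<bar>\<Sum>y\<in>UNIV. ?E $ x $ y\<bar>"
        using elim unfolding eq[symmetric] by (simp add: abs_mult)
      also have "\<dots> \<le> (\<Sum>y\<in>UNIV. \<bar>?E $ x $ y\<bar>)" by (rule sum_abs)
      also have "\<dots> \<le> matrix_norm ?E" by (rule row_sum_le_matrix_norm)
      also have "\<dots> \<le> C * (\<epsilon>\<^sup>2 * (s \<epsilon>)\<^sup>2)" using elim by simp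
      also have "\<dots> = \<epsilon> * s \<epsilon> * (C * (\<epsilon> * s \<epsilon>))" by (simp add: power2_eq_square)
      finally show ?case using elim by simp
    qed
    moreover have "((\<lambda>\<epsilon>. C * (\<epsilon> * s \<epsilon>)) \<longlongrightarrow> 0) (at_right 0)"
      using tendsto_mult_left[OF \<epsilon>s, of C] by simp
    ultimately have "\<bar>?\<rho>\<bar> \<le> 0"
      by (intro tendsto_lowerbound) auto
    then show ?thesis by simp
  qed

  define w where "w = row_of_pmf \<pi> v* Q1"
  define Z where "Z = matrix_inv (rank_one_matrix \<pi> - Q0)"
  define b where "b = w v* Z"
  define a where "a = b v* Z"
  have w: "(\<Sum>x\<in>UNIV. w $ x) = 0"
    unfolding w_def vector_matrix_mult_nth
    by (subst sum.swap) (simp add: sum_distrib_left[symmetric] Q1_row)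
  note b = fundamental_matrix_solution[OF Q0 \<pi> w, folded Z_def b_def]
  note a = fundamental_matrix_solution[OF Q0 \<pi> b(1), folded Z_def a_def]
  from perturbed_forward_equation[OF Q0 \<pi> b(2)[unfolded w_def] a(2,1) b(1) less_imp_le[OF C]]
  obtain c K \<eta> where c: "c > 0" and K: "K \<ge> 0" and \<eta>: "\<eta> > 0"
    and main: "\<And>\<epsilon> S T p Q. 0 < \<epsilon> \<Longrightarrow> 1 \<le> S \<Longrightarrow> \<epsilon> * S \<le> \<eta> \<Longrightarrow>
      (\<And>v x. T - S \<le> v \<Longrightarrow> v \<le> T \<Longrightarrow> 0 \<le> p v $ x) \<Longrightarrow>
      (\<And>v. T - S \<le> v \<Longrightarrow> v \<le> T \<Longrightarrow> (\<Sum>x\<in>UNIV. p v $ x) = 1) \<Longrightarrow>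
      (\<And>x. continuous_on {T - S..T} (\<lambda>v. p v $ x)) \<Longrightarrow>
      (\<And>v x. T - S \<le> v \<Longrightarrow> v < T \<Longrightarrow>
        ((\<lambda>v. p v $ x) has_real_derivative (p v v* Q v) $ x) (at_right v)) \<Longrightarrow>
      (\<And>u. 0 \<le> u \<Longrightarrow> u \<le> S \<Longrightarrow>
        matrix_norm (Q (T - u) - (Q0 - (\<epsilon> * u) *\<^sub>R Q1)) \<le> C * (\<epsilon>\<^sup>2 * S\<^sup>2)) \<Longrightarrow>
      (norm (p T - (row_of_pmf \<pi> - \<epsilon> *\<^sub>R a)))\<^sup>2 \<le> K * (exp (- c * S) + (\<epsilon>\<^sup>2 * S\<^sup>2)\<^sup>2)"
    by blast

  have "((\<lambda>\<epsilon>. exp (- c * s \<epsilon>) / \<epsilon> ^ 4) \<longlongrightarrow> 0) (at_right 0)"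
    by (rule Lim_transform_eventually[OF log_power_asymptotics(3)[OF \<delta> c]])
       (use s_eq in eventually_elim, simp)
  then have exp_small: "\<forall>\<^sub>F \<epsilon> in at_right 0. exp (- c * s \<epsilon>) / \<epsilon> ^ 4 < 1"
    by (rule order_tendstoD) simp
  have \<epsilon>s_small: "\<forall>\<^sub>F \<epsilon> in at_right 0. \<epsilon> * s \<epsilon> < \<eta>"
    using \<epsilon>s \<eta> by (rule order_tendstoD)

  have "\<forall>\<^sub>F \<epsilon> in at_right 0.
      norm (row_of_pmf \<mu> v* P \<epsilon> 0 (t \<epsilon>) - (row_of_pmf \<pi> - \<epsilon> *\<^sub>R a)) \<le> sqrt (2 * K) * (\<epsilon>\<^sup>2 * (s \<epsilon>)\<^sup>2)"
    using pos s1 st bound exp_small \<epsilon>s_small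
  proof eventually_elim
    case (elim \<epsilon>)
    interpret markov_jump_process "M \<epsilon>" "X \<epsilon>" "Q \<epsilon>" using elim(1) by (rule process)
    let ?p = "\<lambda>v. row_of_pmf \<mu> v* transition_matrix (M \<epsilon>) (X \<epsilon>) 0 v"
    have "(norm (?p (t \<epsilon>) - (row_of_pmf \<pi> - \<epsilon> *\<^sub>R a)))\<^sup>2 \<le>
        K * (exp (- c * s \<epsilon>) + (\<epsilon>\<^sup>2 * (s \<epsilon>)\<^sup>2)\<^sup>2)"
    proof (rule main)
      show "continuous_on {t \<epsilon> - s \<epsilon>..t \<epsilon>} (\<lambda>v. ?p v $ x)" for x
        using elim by (intro continuous_on_subset[OF continuous_on_marginal]) auto
    qed (use elim in \<open>auto intro: marginal_nonneg marginal_sum marginal_has_right_derivative\<close>)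
    also have "\<dots> \<le> K * ((\<epsilon>\<^sup>2 * (s \<epsilon>)\<^sup>2)\<^sup>2 + (\<epsilon>\<^sup>2 * (s \<epsilon>)\<^sup>2)\<^sup>2)"
    proof (intro mult_left_mono add_right_mono K)
      \<comment> \<open>The forgotten initial condition is thus no larger than the squared
        perturbation error.\<close>
      have "exp (- c * s \<epsilon>) \<le> \<epsilon> ^ 4" using elim by (simp add: divide_less_eq)
      also have "\<dots> \<le> \<epsilon> ^ 4 * (s \<epsilon>) ^ 4"
        using elim one_le_power[of "s \<epsilon>" 4] by simp
      finally show "exp (- c * s \<epsilon>) \<le> (\<epsilon>\<^sup>2 * (s \<epsilon>)\<^sup>2)\<^sup>2"
        by (simp add: power_mult_distrib flip: power_mult)
    qed
    also have "\<dots> = (sqrt (2 * K) * (\<epsilon>\<^sup>2 * (s \<epsilon>)\<^sup>2))\<^sup>2"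
      using K by (simp add: power_mult_distrib)
    finally have "norm (?p (t \<epsilon>) - (row_of_pmf \<pi> - \<epsilon> *\<^sub>R a)) \<le> sqrt (2 * K) * (\<epsilon>\<^sup>2 * (s \<epsilon>)\<^sup>2)"
      by (rule power2_le_imp_le) (use K in simp)
    then show ?case using elim by (simp add: P)
  qed
  then have "\<forall>\<^sub>F \<epsilon> in at_right 0.
      norm ((row_of_pmf \<mu> v* P \<epsilon> 0 (t \<epsilon>)) \<bullet> r - (row_of_pmf \<pi> \<bullet> r - \<epsilon> * (w \<bullet> ((Z ** Z) *v r))))
        \<le> (sqrt (2 * K) * norm r) * norm (\<epsilon>\<^sup>2 * (s \<epsilon>) ^ 3)"
    using s1
  proof eventually_elim
    case (elim \<epsilon>)
    let ?d = "row_of_pmf \<mu> v* P \<epsilon> 0 (t \<epsilon>) - (row_of_pmf \<pi> - \<epsilon> *\<^sub>R a)"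
    \<comment> \<open>Associativity: the two factors \<open>Z\<close> move from \<open>r\<close> to
      the row vector, giving \<open>a = w Z Z\<close>.\<close>
    have "w \<bullet> ((Z ** Z) *v r) = a \<bullet> r"
      by (simp add: a_def b_def vector_matrix_mul_assoc flip: dot_lmul_matrix)
    then have "norm ((row_of_pmf \<mu> v* P \<epsilon> 0 (t \<epsilon>)) \<bullet> r -
        (row_of_pmf \<pi> \<bullet> r - \<epsilon> * (w \<bullet> ((Z ** Z) *v r)))) = norm (?d \<bullet> r)"
      by (simp add: inner_diff_left)
    also have "\<dots> \<le> norm ?d * norm r" using Cauchy_Schwarz_ineq2[of ?d r] by simp
    also have "\<dots> \<le> (sqrt (2 * K) * (\<epsilon>\<^sup>2 * (s \<epsilon>) ^ 2)) * norm r"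
      using elim(1) by (rule mult_right_mono) simp
    \<comment> \<open>The argument yields the order
      \<open>\<epsilon>\<^sup>2 * (s \<epsilon>)\<^sup>2\<close>; as
      \<open>1 \<le> s \<epsilon>\<close>, it implies the stated one.\<close>
    also have "\<dots> \<le> (sqrt (2 * K) * (\<epsilon>\<^sup>2 * (s \<epsilon>) ^ 3)) * norm r"
      using K elim(2) by (intro mult_right_mono mult_left_mono power_increasing) auto
    finally show ?case using elim(2) by (simp add: abs_mult mult_ac)
  qed
  then show ?thesis
    unfolding w_def Z_def by (rule bigoI)
qed

end
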